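(* Let $\mathfrak g$ be a finite-dimensional real Lie algebra endowed with an ad-invariant metric $\langle\cdot,\cdot\rangle$ and let $\mathfrak v$ be a vector subspace of $\mathfrak g$. Then for all $j\ge 1$, $$\mathrm C^{j}(\mathfrak v)^{\perp}=\mathrm C_j(\mathfrak v),$$ and therefore $$\dim \mathrm C_j(\mathfrak v)+\dim \mathrm C^j(\mathfrak v)=\dim\mathfrak g .$$
   Context: An ad-invariant metric on a real Lie algebra $\mathfrak g$ is a nondegenerate symmetric bilinear form $\langle\cdot,\cdot\rangle:\mathfrak g\times\mathfrak g\to\mathbb R$ (not necessarily positive definite) such that $\langle [X,Y],Z\rangle+\langle Y,[X,Z]\rangle=0$ for all $X,Y,Z\in\mathfrak g$. For a subspace $\mathfrak w\subset\mathfrak g$, $\mathfrak w^\perp=\{Y\in\mathfrak g:\langle X,Y\rangle=0\text{ for all }X\in\mathfrak w\}$. For subspaces $\mathfrak a,\mathfrak c$ of $\mathfrak g$, $[\mathfrak a,\mathfrak c]$ denotes the linear span of all brackets $[A,C]$ with $A\in\mathfrak a$, $C\in\mathfrak c$. For a vector subspace $\mathfrak v\subset\mathfrak g$ define $$\mathrm C^0(\mathfrak v)=\mathfrak v,\qquad \mathrm C^j(\mathfrak v)=[\mathfrak g,\mathrm C^{j-1}(\mathfrak v)]\ \ (j\ge1),$$ $$\mathrm C_0(\mathfrak v)=0,\quad \mathrm C_1(\mathfrak v)=\{X\in\mathfrak g:[X,\mathfrak v]=0\},\quad \mathrm C_j(\mathfrak v)=\{X\in\mathfrak g:[X,\mathfrak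 g]\subset \mathrm C_{j-1}(\mathfrak v)\}\ \ (j\ge2).$$ *)

theory Defs
  imports "HOL-Analysis.Analysis"
begin

text \<open>The underlying space of a Lie algebra is the whole type \<open>'g\<close>. It ranges over
  \<open>real_vector\<close> rather than \<open>euclidean_space\<close>, so that it carries no inner product of its own
  and the zero Lie algebra is included.\<close>

definition finite_dimensional :: "'g::real_vector itself \<Rightarrow> bool" where
  "finite_dimensional _ \<longleftrightarrow> (\<exists>B::'g set. finite B \<and> span B = UNIV)"

locale real_lie_algebra =
  fixes br :: "'g::real_vector \<Rightarrow> 'g \<Rightarrow> 'g"
  assumes bilinear_br: "bilinear br"
    and br_self: "br X X = 0"
    and jacobi: "br X (br Y Z) + br Y (br Z X) + br Z (br X Y) = 0"

locale ad_invariant_metric = real_lie_algebra br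
  for br :: "'g::real_vector \<Rightarrow> 'g \<Rightarrow> 'g" +
  fixes m :: "'g \<Rightarrow> 'g \<Rightarrow> real"
  assumes bilinear_metric: "bilinear m"
    and metric_sym: "m X Y = m Y X"
    and metric_nondegenerate: "(\<And>Y. m X Y = 0) \<Longrightarrow> X = 0"
    and metric_ad_invariant: "m (br X Y) Z + m Y (br X Z) = 0"

definition metric_perp :: "('g \<Rightarrow> 'g \<Rightarrow> real) \<Rightarrow> 'g set \<Rightarrow> 'g set" where
  "metric_perp m W = {Y. \<forall>X\<in>W. m X Y = 0}"

definition bracket_span :: "('g \<Rightarrow> 'g \<Rightarrow> 'g) \<Rightarrow> 'g set \<Rightarrow> 'g set \<Rightarrow> 'g::real_vector set" where
  "bracket_span br A C = span {br a c | a c. a \<in> A \<and> c \<in> C}"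

text \<open>\<open>C_upper br V j\<close> is \<open>C\<^sup>j(V)\<close> and \<open>C_lower br V j\<close> is \<open>C\<^sub>j(V)\<close>.\<close>

primrec C_upper :: "('g \<Rightarrow> 'g \<Rightarrow> 'g) \<Rightarrow> 'g set \<Rightarrow> nat \<Rightarrow> 'g::real_vector set" where
  "C_upper br V 0 = V"
| "C_upper br V (Suc j) = bracket_span br UNIV (C_upper br V j)"

text \<open>The step from 0 to 1 does not follow the recursion: \<open>C\<^sub>1(V)\<close> is the centralizer of \<open>V\<close>,
  and \<open>V\<close> enters only there.\<close>

fun C_lower :: "('g \<Rightarrow> 'g \<Rightarrow> 'g) \<Rightarrow> 'g set \<Rightarrow> nat \<Rightarrow> 'g::real_vector set" where
  "C_lower br V 0 = {0}"
| "C_lower br V (Suc 0) = {X. \<forall>Y\<in>V. br X Y = 0}"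
| "C_lower br V (Suc (Suc j)) = {X. \<forall>Y. br X Y \<in> C_lower br V (Suc j)}"

end

theory Submission imports Defs begin

text \<open>Since \<open>'g\<close> is only a \<open>real_vector\<close>, finite dimension is a
  hypothesis about a basis; this turns such a basis into an instance of the locale, where injective
  endomorphisms are known to be onto.\<close>

lemma finite_dimensional_vector_space_scaleR:
  assumes "finite B" "independent B" "span B = (UNIV :: 'g::real_vector set)"
  shows "finite_dimensional_vector_space ((*\<^sub>R) :: real \<Rightarrow> 'g \<Rightarrow> 'g) B"
  using assms
  by unfold_locales (auto simp: dependent_raw_def[symmetric] span_raw_def[symmetric])

text \<open>Coordinates with respect to an independent set are unique, so an expansion over
  \<open>S\<close> must agree with the given one over \<open>T\<close>.\<close>

lemma in_span_sum_iff:
  fixes S T :: "'g::real_vector set"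
  assumes "finite T" "independent T" "S \<subseteq> T"
  shows "(\<Sum>b\<in>T. c b *\<^sub>R b) \<in> span S \<longleftrightarrow> (\<forall>b\<in>T - S. c b = 0)"
proof
  assume "\<forall>b\<in>T - S. c b = 0"
  then have "(\<Sum>b\<in>T. c b *\<^sub>R b) = (\<Sum>b\<in>S. c b *\<^sub>R b)"
    using assms by (intro sum.mono_neutral_right) auto
  then show "(\<Sum>b\<in>T. c b *\<^sub>R b) \<in> span S"
    by (simp add: span_sum span_scale span_base)
next
  assume "(\<Sum>b\<in>T. c b *\<^sub>R b) \<in> span S"
  then obtain d where d: "(\<Sum>b\<in>T. c b *\<^sub>R b) = (\<Sum>b\<in>S. d b *\<^sub>R b)"
    using span_finite[of S] finite_subset[OF assms(3,1)] by auto
  \<comment> \<open>Extension by zero puts both expansions over \<open>T\<close>, so independence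
    compares them coefficient by coefficient.\<close>
  define d' where "d' b = (if b \<in> S then d b else 0)" for b
  have "(\<Sum>b\<in>T. d' b *\<^sub>R b) = (\<Sum>b\<in>S. d b *\<^sub>R b)"
    using assms by (intro sum.mono_neutral_cong_right) (auto simp: d'_def)
  with d have "(\<Sum>b\<in>T. (c b - d' b) *\<^sub>R b) = 0"
    by (simp add: scaleR_left_diff_distrib sum_subtractf)
  then have "c b - d' b = 0" if "b \<in> T" for b
    using independentD[OF assms(2,1) order_refl, of "\<lambda>b. c b - d' b"] that by blast
  then show "\<forall>b\<in>T - S. c b = 0"
    by (auto simp: d'_def)
qed

text \<open>Linearity in the first argument lets orthogonality be tested on generators: basis
  vectors in \<open>dim_metric_perp\<close>, single brackets in
  \<open>metric_perp_bracket_span\<close>.\<close>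

lemma metric_perp_span:
  fixes m :: "'g::real_vector \<Rightarrow> 'g \<Rightarrow> real"
  assumes "bilinear m"
  shows "metric_perp m (span S) = metric_perp m S"
proof
  show "metric_perp m (span S) \<subseteq> metric_perp m S"
    by (auto simp: metric_perp_def span_base)
  have "m x y = 0" if "x \<in> span S" "\<forall>x\<in>S. m x y = 0" for x y
    using that(1)
    by (induction rule: span_induct_alt)
      (use that(2) assms in \<open>auto simp: bilinear_lzero bilinear_ladd bilinear_lmul\<close>)
  then show "metric_perp m S \<subseteq> metric_perp m (span S)"
    by (auto simp: metric_perp_def)
qed

text \<open>Extend a basis \<open>S\<close> of \<open>W\<close> to a basis \<open>T\<close>. By nondegeneracy \<open>Y \<mapsto> (m b Y)\<^sub>b\<close> is a
  linear automorphism in the coordinates of \<open>T\<close>; it maps \<open>W\<^sup>\<bottom>\<close> onto \<open>span (T - S)\<close>.\<close>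
lemma dim_metric_perp:
  fixes m :: "'g::real_vector \<Rightarrow> 'g \<Rightarrow> real"
  assumes fd: "finite_dimensional TYPE('g)"
    and bil: "bilinear m"
    and nondeg: "\<And>Y. (\<And>X. m X Y = 0) \<Longrightarrow> Y = 0"
    and W: "subspace W"
  shows "dim (metric_perp m W) + dim W = dim (UNIV :: 'g set)"
proof -
  obtain S where S: "S \<subseteq> W" "independent S" "span S = W"
    using basis_exists[of W] W by (metis span_minimal subset_antisym)
  obtain T where T: "S \<subseteq> T" "independent T" "span T = UNIV"
    using maximal_independent_subset_extend[OF subset_UNIV S(2)]
    by (metis UNIV_eq_I subsetD UNIV_I)
  obtain B0 :: "'g set" where "finite B0" "span B0 = UNIV"
    using fd by (auto simp: finite_dimensional_def)
  then have fT: "finite T"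
    using independent_span_bound T(2) by blast
  interpret pair: finite_dimensional_vector_space_pair_1
    "(*\<^sub>R) :: real \<Rightarrow> 'g \<Rightarrow> 'g" T "(*\<^sub>R) :: real \<Rightarrow> 'g \<Rightarrow> 'g"
    by (intro finite_dimensional_vector_space_pair_1.intro real_vector.vector_space_axioms
        finite_dimensional_vector_space_scaleR fT T(2,3))
  define L where "L Y = (\<Sum>b\<in>T. m b Y *\<^sub>R b)" for Y
  have lin: "linear L"
    unfolding L_def
    by (rule linearI)
      (simp_all add: bilinear_radd[OF bil] bilinear_rmul[OF bil] scaleR_left_distrib
        sum.distrib scaleR_right.sum)
  \<comment> \<open>Used twice: \<open>R = T\<close> makes the left side \<open>L Y = 0\<close> and
    yields injectivity; \<open>R = S\<close> describes the orthogonal of \<open>W\<close> as a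
    preimage.\<close>
  have perp: "L Y \<in> span (T - R) \<longleftrightarrow> Y \<in> metric_perp m (span R)" if "R \<subseteq> T" for R Y
    using in_span_sum_iff[OF fT T(2), of "T - R" "\<lambda>b. m b Y"] that
    unfolding L_def metric_perp_span[OF bil] by (auto simp: metric_perp_def)
  have inj: "inj L"
  proof (subst linear_injective_0[OF lin], intro allI impI)
    fix Y assume "L Y = 0"
    then show "Y = 0"
      using perp[OF order_refl, of Y] T(3) nondeg by (auto simp: metric_perp_def)
  qed
  \<comment> \<open>Surjectivity turns that preimage description into an equality for the
    image.\<close>
  have "surj L"
    using pair.vs1.linear_inj_imp_surj[of L] lin inj by (simp add: linear_def)
  then have "L ` metric_perp m W = span (T - S)"
    using perp[OF T(1)] S(3) by (force simp: surj_def)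
  then have "dim (metric_perp m W) = dim (span (T - S))"
    using pair.dim_image_eq[of L "metric_perp m W"] lin inj_on_subset[OF inj subset_UNIV]
    by (simp add: linear_def dim_raw_def)
  also have "\<dots> = card (T - S)"
    using independent_mono[OF T(2)] by (simp add: dim_eq_card_independent)
  finally show ?thesis
    using dim_eq_card_independent[OF S(2)] dim_eq_card_independent[OF T(2)]
      dim_span[of S] dim_span[of T] S(3) T(3) card_mono[OF fT T(1)]
      card_Diff_subset[OF finite_subset[OF T(1) fT] T(1)]
    by simp
qed

lemma subspace_C_upper: "subspace V \<Longrightarrow> subspace (C_upper br V j)"
  by (cases j) (simp_all add: bracket_span_def)

context ad_invariant_metric
begin

lemma br_antisym: "br Y X = - br X Y"
proof -
  have "br (X + Y) (X + Y) = br X Y + br Y X"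
    unfolding bilinear_ladd[OF bilinear_br] bilinear_radd[OF bilinear_br] by (simp add: br_self)
  then show ?thesis
    by (simp add: br_self eq_neg_iff_add_eq_0 add.commute)
qed

text \<open>Ad-invariance moves \<open>br A\<close> across the metric at the cost of a sign, which
  antisymmetry absorbs by swapping \<open>A\<close> and \<open>X\<close>.\<close>

lemma metric_br_left: "m (br A C) X = m C (br X A)"
  using metric_ad_invariant[of A C X] br_antisym[of A X] bilinear_rneg[OF bilinear_metric]
  by simp

text \<open>Taking orthogonals turns the recursion of \<open>C_upper\<close> into the one that
  defines \<open>C_lower\<close> from index 1 on; this is the induction step below.\<close>

lemma metric_perp_bracket_span:
  "metric_perp m (bracket_span br UNIV W) = {X. \<forall>A. br X A \<in> metric_perp m W}"
  unfolding bracket_span_def metric_perp_span[OF bilinear_metric]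
  by (auto simp: metric_perp_def) (metis metric_br_left)+

text \<open>The induction starts at index 1: at index 0 \<open>C_lower\<close> is zero whatever
  \<open>V\<close> is, while the orthogonal of \<open>V\<close> need not be.\<close>

lemma metric_perp_C_upper: "metric_perp m (C_upper br V (Suc j)) = C_lower br V (Suc j)"
proof (induction j)
  case 0
  \<comment> \<open>This frees the arbitrary vector \<open>A\<close> from the bracket, so that
    nondegeneracy forces \<open>br C X = 0\<close>.\<close>
  have "m C (br X A) = m A (br C X)" for C X A
    using metric_br_left[of X A C] metric_sym by simp
  moreover have "(\<forall>A. m A (br C X) = 0) \<longleftrightarrow> br X C = 0" for C X
    using metric_nondegenerate[of "br C X"] metric_sym br_antisym[of X C]
      bilinear_rzero[OF bilinear_metric] by auto
  ultimately have "(\<forall>A. m C (br X A) = 0) \<longleftrightarrow> br X C = 0" for C X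
    by metis
  then have "(\<forall>A. \<forall>C\<in>V. m C (br X A) = 0) \<longleftrightarrow> (\<forall>C\<in>V. br X C = 0)" for X
    by blast
  then show ?case
    by (simp add: metric_perp_bracket_span) (simp add: metric_perp_def)
next
  case (Suc j)
  then show ?case
    using metric_perp_bracket_span[of "C_upper br V (Suc j)"] by simp
qed

end

theorem proposition2p2:
  fixes br :: "'g::real_vector \<Rightarrow> 'g \<Rightarrow> 'g"
    and m :: "'g \<Rightarrow> 'g \<Rightarrow> real"
    and V :: "'g set"
  assumes "finite_dimensional TYPE('g)"
    and "ad_invariant_metric br m"
    and "subspace V"
  shows "\<forall>j\<ge>1. metric_perp m (C_upper br V j) = C_lower br V j \<and>
               dim (C_lower br V j) + dim (C_upper br V j) = dim (UNIV :: 'g set)"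
proof (intro allI impI)
  fix j :: nat assume "j \<ge> 1"
  then obtain i where j: "j = Suc i"
    by (cases j) auto
  interpret ad_invariant_metric br m by fact
  have perp: "metric_perp m (C_upper br V j) = C_lower br V j"
    unfolding j by (rule metric_perp_C_upper)
  \<comment> \<open>The locale states nondegeneracy for the left argument,
    \<open>dim_metric_perp\<close> asks for the right one; symmetry converts.\<close>
  have "Y = 0" if "\<And>X. m X Y = 0" for Y
    using that metric_nondegenerate metric_sym by metis
  then have "dim (metric_perp m (C_upper br V j)) + dim (C_upper br V j) = dim (UNIV :: 'g set)"
    by (rule dim_metric_perp[OF assms(1) bilinear_metric _ subspace_C_upper[OF assms(3)]])
  with perp show "metric_perp m (C_upper br V j) = C_lower br V j \<and>
      dim (C_lower br V j) + dim (C_upper br V j) = dim (UNIV :: 'g set)"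
    by simp
qed

end
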